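(* Let $1\leq p<\infty$, let $I$ be any index set and let $(X_i)_{i\in I}$ be a family of Banach spaces. If every $X_i$ has the Opial property, then the $\ell^p$-sum $X:=\bigl[\bigoplus_{i\in I}X_i\bigr]_p$ also has the Opial property. If every $X_i$ has the nonstrict Opial property, then $X$ also has the nonstrict Opial property.
   Context: All Banach spaces are real. The $\ell^p$-sum $\bigl[\bigoplus_{i\in I}X_i\bigr]_p$ is the Banach space of all $(x_i)_{i\in I}\in\prod_{i\in I}X_i$ with $(\|x_i\|)_{i\in I}\in\ell^p(I)$, with norm $\|(x_i)_{i\in I}\|_p:=\bigl(\sum_{i\in I}\|x_i\|^p\bigr)^{1/p}$. A Banach space $X$ has the Opial property if $\limsup_{n\to\infty}\|x_n\|<\limsup_{n\to\infty}\|x_n-x\|$ holds for every weakly null sequence $(x_n)_{n\in\mathbb{N}}$ in $X$ and every $x\in X\setminus\{0\}$. It has the nonstrict Opial property if the same holds with "$\leq$" in place of "$<$". *)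

theory Defs
  imports "HOL-Analysis.Analysis" "HOL-Library.Function_Algebras"
begin

instantiation "fun" :: (type, real_vector) real_vector
begin

definition scaleR_fun :: "real \<Rightarrow> ('a \<Rightarrow> 'b) \<Rightarrow> 'a \<Rightarrow> 'b" where
  "scaleR_fun c f = (\<lambda>x. c *\<^sub>R f x)"

instance
  by standard (simp_all add: scaleR_fun_def fun_eq_iff scaleR_add_right scaleR_add_left)

end

text \<open>
  A Banach space is given by a pair of a linear subspace \<open>V\<close> of some real vector space and a
  norm \<open>N\<close> on \<open>V\<close>; the values of \<open>N\<close> outside \<open>V\<close> are irrelevant.  The type of the
  ambient space only supplies the vector space operations (it carries no norm or topology).
  Thus a family of Banach spaces, with unrelated norms, becomes a family of such pairs with a
  common ambient type.  This is no restriction: any family of vector spaces embeds into a common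
  vector space, for instance into its algebraic direct sum.
\<close>

definition norm_on :: "'a::real_vector set \<Rightarrow> ('a \<Rightarrow> real) \<Rightarrow> bool" where
  "norm_on V N \<longleftrightarrow>
     (\<forall>x\<in>V. 0 \<le> N x \<and> (N x = 0 \<longleftrightarrow> x = 0)) \<and>
     (\<forall>c. \<forall>x\<in>V. N (c *\<^sub>R x) = \<bar>c\<bar> * N x) \<and>
     (\<forall>x\<in>V. \<forall>y\<in>V. N (x + y) \<le> N x + N y)"

definition complete_on :: "'a::real_vector set \<Rightarrow> ('a \<Rightarrow> real) \<Rightarrow> bool" where
  "complete_on V N \<longleftrightarrow>
     (\<forall>x :: nat \<Rightarrow> 'a. (\<forall>n. x n \<in> V) \<longrightarrow>
        (\<forall>e>0. \<exists>M. \<forall>m\<ge>M. \<forall>n\<ge>M. N (x m - x n) < e) \<longrightarrow>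
        (\<exists>l\<in>V. (\<lambda>n. N (x n - l)) \<longlonglongrightarrow> 0))"

definition banach_space_on :: "'a::real_vector set \<Rightarrow> ('a \<Rightarrow> real) \<Rightarrow> bool" where
  "banach_space_on V N \<longleftrightarrow> subspace V \<and> norm_on V N \<and> complete_on V N"

definition bounded_functional_on ::
    "'a::real_vector set \<Rightarrow> ('a \<Rightarrow> real) \<Rightarrow> ('a \<Rightarrow> real) \<Rightarrow> bool" where
  "bounded_functional_on V N f \<longleftrightarrow>
     (\<forall>x\<in>V. \<forall>y\<in>V. f (x + y) = f x + f y) \<and>
     (\<forall>c. \<forall>x\<in>V. f (c *\<^sub>R x) = c * f x) \<and>
     (\<exists>K. \<forall>x\<in>V. \<bar>f x\<bar> \<le> K * N x)"

definition weakly_null_on ::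
    "'a::real_vector set \<Rightarrow> ('a \<Rightarrow> real) \<Rightarrow> (nat \<Rightarrow> 'a) \<Rightarrow> bool" where
  "weakly_null_on V N x \<longleftrightarrow>
     (\<forall>n. x n \<in> V) \<and> (\<forall>f. bounded_functional_on V N f \<longrightarrow> (\<lambda>n. f (x n)) \<longlonglongrightarrow> 0)"

definition opial_property :: "'a::real_vector set \<Rightarrow> ('a \<Rightarrow> real) \<Rightarrow> bool" where
  "opial_property V N \<longleftrightarrow>
     (\<forall>xs x. weakly_null_on V N xs \<longrightarrow> x \<in> V - {0} \<longrightarrow>
        limsup (\<lambda>n. ereal (N (xs n))) < limsup (\<lambda>n. ereal (N (xs n - x))))"

definition nonstrict_opial_property :: "'a::real_vector set \<Rightarrow> ('a \<Rightarrow> real) \<Rightarrow> bool" where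
  "nonstrict_opial_property V N \<longleftrightarrow>
     (\<forall>xs x. weakly_null_on V N xs \<longrightarrow> x \<in> V - {0} \<longrightarrow>
        limsup (\<lambda>n. ereal (N (xs n))) \<le> limsup (\<lambda>n. ereal (N (xs n - x))))"

text \<open>
  A family indexed by \<open>I\<close> is represented by a function on the whole index type which vanishes
  outside \<open>I\<close>, so that the sum is a linear subspace of the function space.
\<close>

definition lp_sum ::
    "real \<Rightarrow> 'i set \<Rightarrow> ('i \<Rightarrow> 'b::real_vector set) \<Rightarrow> ('i \<Rightarrow> 'b \<Rightarrow> real) \<Rightarrow> ('i \<Rightarrow> 'b) set" where
  "lp_sum p I V N =
     {x. (\<forall>i\<in>I. x i \<in> V i) \<and> (\<forall>i. i \<notin> I \<longrightarrow> x i = 0) \<and>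
         (\<lambda>i. N i (x i) powr p) summable_on I}"

definition lp_sum_norm ::
    "real \<Rightarrow> 'i set \<Rightarrow> ('i \<Rightarrow> 'b \<Rightarrow> real) \<Rightarrow> ('i \<Rightarrow> 'b) \<Rightarrow> real" where
  "lp_sum_norm p I N x = (\<Sum>\<^sub>\<infinity>i\<in>I. N i (x i) powr p) powr (1 / p)"

end

theory Submission
  imports Defs
begin

text \<open>
  The Opial inequality compares two limits superior, which may be attained along different
  subsequences, so it does not sum up over the index set.  The proof replaces it by an inequality
  between terms.  A space has the Opial property if and only if for every weakly null sequence
  \<open>y\<close> and every \<open>x \<noteq> 0\<close> there is a gap \<open>d > 0\<close> with \<open>\<parallel>y n\<parallel> + d \<le> \<parallel>y n - x\<parallel>\<close> for almost
  all \<open>n\<close> (\<open>opial_property_iff_gap\<close>): without a gap, a subsequence of \<open>y\<close>, which is weakly null as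
  well, would violate the property.  The nonstrict property means the same with \<open>- e\<close> for arbitrary
  \<open>e > 0\<close> in place of \<open>d\<close> (\<open>nonstrict_opial_property_iff_gap\<close>).  The gaps survive the passage from norms
  to their \<open>p\<close>-th powers and back as long as the norms stay bounded.

  Now let \<open>y\<close> be weakly null in the \<open>\<ell>\<^sup>p\<close>-sum and \<open>x \<noteq> 0\<close>.  Every coordinate of \<open>y\<close> is weakly null.  Cut
  \<open>x\<close> down to a finite index set \<open>F\<close>; the resulting \<open>x\<^sub>F\<close> is as close to \<open>x\<close> as desired, and
  \<open>\<parallel>y n - x\<^sub>F\<parallel>\<^sup>p - \<parallel>y n\<parallel>\<^sup>p\<close> is a sum over \<open>F\<close> of the corresponding differences in the coordinates
  (\<open>lp_sum_norm_diff_restrict\<close>).  Each of the finitely many terms is eventually almost nonnegative, which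
  gives the nonstrict property.  For the strict one, fix a single \<open>j\<close> with \<open>x j \<noteq> 0\<close>: its term is
  eventually at least some \<open>d > 0\<close> that depends on \<open>j\<close> but not on \<open>F\<close>, so the gap at \<open>j\<close> persists when \<open>F\<close>
  is chosen large enough to make \<open>\<parallel>x - x\<^sub>F\<parallel>\<close> negligible against it.

  The two equivalences also need that weakly null sequences are bounded (\<open>weakly_null_on_bounded\<close>): if
  the limits superior were infinite, a gap between the terms would not separate them.  Boundedness is
  an instance of the uniform boundedness principle.  Its proof takes, for every vector, a functional of
  norm at most one that attains the norm there, which the Hahn--Banach theorem provides, and adds
  multiples of such functionals in a gliding hump argument.
\<close>

section \<open>The Hahn--Banach theorem for sublinear functionals\<close>

definition sublinear_on :: "'a::real_vector set \<Rightarrow> ('a \<Rightarrow> real) \<Rightarrow> bool" where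
  "sublinear_on V q \<longleftrightarrow>
     (\<forall>x\<in>V. \<forall>y\<in>V. q (x + y) \<le> q x + q y) \<and> (\<forall>c\<ge>0. \<forall>x\<in>V. q (c *\<^sub>R x) = c * q x)"

lemma sublinear_onI:
  assumes "subspace V"
    and add: "\<And>x y. x \<in> V \<Longrightarrow> y \<in> V \<Longrightarrow> q (x + y) \<le> q x + q y"
    and zero: "q 0 = 0"
    and scale: "\<And>c x. c > 0 \<Longrightarrow> x \<in> V \<Longrightarrow> q (c *\<^sub>R x) \<le> c * q x"
  shows "sublinear_on V q"
proof -
  have "q (c *\<^sub>R x) = c * q x" if "c \<ge> 0" "x \<in> V" for c x
  proof (cases "c = 0")
    case False
    with that have c: "c > 0" by simp
    have "c *\<^sub>R x \<in> V" using assms(1) that by (simp add: subspace_scale)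
    from scale[OF _ this, of "1 / c"] c have "q x \<le> q (c *\<^sub>R x) / c" by simp
    with c have "c * q x \<le> q (c *\<^sub>R x)" by (simp add: field_simps)
    with scale[OF c \<open>x \<in> V\<close>] show ?thesis by simp
  qed (simp add: zero)
  with add show ?thesis unfolding sublinear_on_def by blast
qed

lemma sublinear_on_zero:
  assumes "subspace V" "sublinear_on V q"
  shows "q 0 = 0"
proof -
  have "q (0 *\<^sub>R 0) = 0 * q 0"
    using assms subspace_0 unfolding sublinear_on_def by blast
  then show ?thesis by simp
qed

lemma sublinear_on_minus_le:
  assumes "subspace V" "sublinear_on V q" "x \<in> V"
  shows "- q (- x) \<le> q x"
proof -
  have "q (x + - x) \<le> q x + q (- x)"
    using assms unfolding sublinear_on_def by (meson subspace_neg)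
  then show ?thesis using sublinear_on_zero[OF assms(1,2)] by simp
qed

lemma norm_on_imp_sublinear_on:
  assumes "norm_on V N"
  shows "sublinear_on V N"
  using assms unfolding norm_on_def sublinear_on_def by auto

lemma le_cINF_add_cINF:
  fixes f :: "'a \<Rightarrow> real" and g :: "'b \<Rightarrow> real"
  assumes "A \<noteq> {}" "B \<noteq> {}"
    and le: "\<And>a b. a \<in> A \<Longrightarrow> b \<in> B \<Longrightarrow> c \<le> f a + g b"
  shows "c \<le> (INF a\<in>A. f a) + (INF b\<in>B. g b)"
proof -
  have "c - (INF a\<in>A. f a) \<le> g b" if "b \<in> B" for b
  proof -
    have "c - g b \<le> (INF a\<in>A. f a)"
      using assms(1) le that by (intro cINF_greatest) (auto simp: algebra_simps)
    then show ?thesis by simp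
  qed
  then have "c - (INF a\<in>A. f a) \<le> (INF b\<in>B. g b)"
    using assms(2) by (intro cINF_greatest) auto
  then show ?thesis by simp
qed

text \<open>
  If \<open>q (- y) > - q y\<close>, then \<open>q\<close> is not additive on the line through \<open>y\<close>, and this lemma makes it
  smaller.  The functional \<open>r\<close> is the best bound that a linear functional below \<open>q\<close> with value \<open>q y\<close>
  at \<open>y\<close> would have to obey: its value at \<open>x\<close> is its value at \<open>x + t y\<close> minus \<open>t q y\<close>.
  The lemma has two uses: it shows that a minimal sublinear functional is odd, and it lets one prescribe
  the value of a linear functional at a point.
\<close>

lemma sublinear_on_decrease:
  assumes V: "subspace V" and q: "sublinear_on V q" and y: "y \<in> V"
  obtains r where "sublinear_on V r" "\<And>x. x \<in> V \<Longrightarrow> r x \<le> q x" "r (- y) \<le> - q y"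
proof
  define h where "h x t = q (x + t *\<^sub>R y) - t * q y" for x t
  define r where "r x = (INF t\<in>{0..}. h x t)" for x
  have mem: "x + t *\<^sub>R y \<in> V" if "x \<in> V" for x t
    using that V y by (simp add: subspace_add subspace_scale)
  have add: "q (u + v) \<le> q u + q v" if "u \<in> V" "v \<in> V" for u v
    using q that unfolding sublinear_on_def by blast
  have scale: "q (c *\<^sub>R u) = c * q u" if "u \<in> V" "c \<ge> 0" for u c
    using q that unfolding sublinear_on_def by blast
  have bdd: "bdd_below (h x ` {0..})" if "x \<in> V" for x
  proof (rule bdd_belowI2)
    fix t :: real assume "t \<in> {0..}"
    then have "t * q y = q (t *\<^sub>R y)" using scale y by simp
    also have "\<dots> = q ((x + t *\<^sub>R y) + - x)" by simp
    also have "\<dots> \<le> q (x + t *\<^sub>R y) + q (- x)"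
      using that V by (intro add mem subspace_neg)
    finally show "- q (- x) \<le> h x t" unfolding h_def by simp
  qed
  have r_le: "r x \<le> h x t" if "x \<in> V" "t \<ge> 0" for x t
    unfolding r_def using that by (intro cINF_lower bdd) auto
  show le: "r x \<le> q x" if "x \<in> V" for x
    using r_le[OF that, of 0] by (simp add: h_def)
  show "r (- y) \<le> - q y"
    using r_le[of "- y" 1] y V sublinear_on_zero[OF V q] by (simp add: h_def subspace_neg)
  show "sublinear_on V r"
  proof (rule sublinear_onI[OF V])
    fix x z assume xz: "x \<in> V" "z \<in> V"
    show "r (x + z) \<le> r x + r z"
      unfolding r_def[of x] r_def[of z]
    proof (rule le_cINF_add_cINF)
      fix s t :: real assume st: "s \<in> {0..}" "t \<in> {0..}"
      have "r (x + z) \<le> h (x + z) (s + t)"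
        using xz st V by (intro r_le) (auto simp: subspace_add)
      also have "\<dots> = q ((x + s *\<^sub>R y) + (z + t *\<^sub>R y)) - (s + t) * q y"
        by (simp add: h_def algebra_simps)
      also have "\<dots> \<le> h x s + h z t"
        using add[OF mem[OF xz(1)] mem[OF xz(2)], of s t] by (simp add: h_def algebra_simps)
      finally show "r (x + z) \<le> h x s + h z t" .
    qed auto
  next
    have "0 \<le> h 0 t" if "t \<ge> 0" for t using that y scale by (simp add: h_def)
    then have "0 \<le> r 0" unfolding r_def by (intro cINF_greatest) auto
    moreover have "r 0 \<le> 0" using le[of 0] V sublinear_on_zero[OF V q] by (simp add: subspace_0)
    ultimately show "r 0 = 0" by simp
  next
    fix c :: real and x assume c: "c > 0" and x: "x \<in> V"
    have "r (c *\<^sub>R x) / c \<le> r x"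
      unfolding r_def[of x]
    proof (rule cINF_greatest)
      fix t :: real assume t: "t \<in> {0..}"
      have "r (c *\<^sub>R x) \<le> h (c *\<^sub>R x) (c * t)"
        using c x t V by (intro r_le) (auto simp: subspace_scale)
      also have "\<dots> = q (c *\<^sub>R (x + t *\<^sub>R y)) - c * t * q y"
        by (simp add: h_def algebra_simps)
      also have "\<dots> = c * h x t"
        using scale[OF mem[OF x, of t], of c] c by (simp add: h_def algebra_simps)
      finally show "r (c *\<^sub>R x) / c \<le> h x t" using c by (simp add: field_simps)
    qed simp
    then show "r (c *\<^sub>R x) \<le> c * r x" using c by (simp add: field_simps)
  qed
qed

text \<open>
  A minimal element among the sublinear functionals below \<open>p\<close> is linear: by minimality the previous lemma
  cannot decrease it, so it is odd, and an odd sublinear functional is linear.  Minimal elements exist by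
  Zorn's lemma, because the pointwise infimum of a chain is again sublinear; \<open>- p (- x)\<close> bounds the chain
  from below at \<open>x\<close>.
\<close>

proposition Hahn_Banach_sublinear:
  assumes V: "subspace V" and p: "sublinear_on V p"
  obtains f where "\<And>x y. x \<in> V \<Longrightarrow> y \<in> V \<Longrightarrow> f (x + y) = f x + f y"
    "\<And>c x. x \<in> V \<Longrightarrow> f (c *\<^sub>R x) = c * f x" "\<And>x. x \<in> V \<Longrightarrow> f x \<le> p x"
proof -
  \<comment> \<open>The values outside \<open>V\<close> are fixed to be \<open>0\<close> to make the pointwise order antisymmetric
    without restricting it to \<open>V\<close>.\<close>
  define A where "A = {q. sublinear_on V q \<and> (\<forall>x\<in>V. q x \<le> p x) \<and> (\<forall>x. x \<notin> V \<longrightarrow> q x = 0)}"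
  have "\<exists>m\<in>A. \<forall>a\<in>A. a \<le> m \<longrightarrow> a = m"
  proof (rule predicate_Zorn)
    show "partial_order_on A (relation_of (\<lambda>a b. b \<le> a) A)"
      by (rule partial_order_on_relation_ofI) auto
  next
    fix C assume "C \<in> Chains (relation_of (\<lambda>a b. b \<le> a) A)"
    then have CA: "C \<subseteq> A" and chain: "\<And>a b. a \<in> C \<Longrightarrow> b \<in> C \<Longrightarrow> a \<le> b \<or> b \<le> a"
      unfolding Chains_def relation_of_def by auto
    show "\<exists>u\<in>A. \<forall>a\<in>C. u \<le> a"
    proof (cases "C = {}")
      case True
      have "sublinear_on V (\<lambda>x. if x \<in> V then p x else 0)"
        using p V unfolding sublinear_on_def by (simp add: subspace_add subspace_scale)
      then have "(\<lambda>x. if x \<in> V then p x else 0) \<in> A"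
        unfolding A_def by simp
      with True show ?thesis by auto
    next
      case False
      define u where "u x = (if x \<in> V then INF q\<in>C. q x else 0)" for x
      have sub: "sublinear_on V q" and below: "\<And>x. x \<in> V \<Longrightarrow> q x \<le> p x"
        and out: "\<And>x. x \<notin> V \<Longrightarrow> q x = 0" if "q \<in> C" for q
        using CA that unfolding A_def by auto
      have u_le: "u x \<le> q x" if "q \<in> C" for q x
      proof (cases "x \<in> V")
        case True
        have "bdd_below ((\<lambda>q. q x) ` C)"
        proof (rule bdd_belowI2)
          fix q assume q: "q \<in> C"
          have "- p (- x) \<le> - q (- x)" using below[OF q] True V by (simp add: subspace_neg)
          also have "\<dots> \<le> q x" by (rule sublinear_on_minus_le[OF V sub[OF q] True])
          finally show "- p (- x) \<le> q x" .
        qed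
        from cINF_lower[OF this that] True show ?thesis by (simp add: u_def)
      qed (use that in \<open>simp add: u_def out\<close>)
      have "sublinear_on V u"
      proof (rule sublinear_onI[OF V])
        fix x y assume xy: "x \<in> V" "y \<in> V"
        have "u (x + y) \<le> (INF q\<in>C. q x) + (INF q\<in>C. q y)"
        proof (rule le_cINF_add_cINF[OF False False])
          fix a b assume ab: "a \<in> C" "b \<in> C"
          \<comment> \<open>Of two members of a chain, the smaller one bounds both summands.\<close>
          then obtain q where q: "q \<in> C" "q \<le> a" "q \<le> b" using chain[OF ab] by auto
          have "u (x + y) \<le> q (x + y)" by (rule u_le[OF q(1)])
          also have "\<dots> \<le> q x + q y" using sub[OF q(1)] xy unfolding sublinear_on_def by blast
          also have "\<dots> \<le> a x + b y" using q by (intro add_mono) (auto simp: le_fun_def)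
          finally show "u (x + y) \<le> a x + b y" .
        qed
        with xy show "u (x + y) \<le> u x + u y" by (simp add: u_def)
      next
        have "(INF q\<in>C. q 0) = (INF q\<in>C. (0::real))"
          using sublinear_on_zero[OF V sub] by (intro INF_cong) auto
        with V False show "u 0 = 0" by (simp add: u_def subspace_0)
      next
        fix c :: real and x assume c: "c > 0" and x: "x \<in> V"
        have "u (c *\<^sub>R x) / c \<le> (INF q\<in>C. q x)"
        proof (rule cINF_greatest[OF False])
          fix q assume q: "q \<in> C"
          have "u (c *\<^sub>R x) \<le> q (c *\<^sub>R x)" by (rule u_le[OF q])
          also have "\<dots> = c * q x" using sub[OF q] c x unfolding sublinear_on_def by simp
          finally show "u (c *\<^sub>R x) / c \<le> q x" using c by (simp add: field_simps)
        qed
        with c x show "u (c *\<^sub>R x) \<le> c * u x" by (simp add: u_def field_simps)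
      qed
      moreover have "u x \<le> p x" if "x \<in> V" for x
        using False u_le below[OF _ that] by (meson all_not_in_conv order_trans)
      ultimately have "u \<in> A" unfolding A_def by (simp add: u_def)
      with u_le show ?thesis by (auto simp: le_fun_def)
    qed
  qed
  then obtain m where "m \<in> A" and min: "\<And>a. a \<in> A \<Longrightarrow> a \<le> m \<Longrightarrow> a = m" by blast
  then have m: "sublinear_on V m" "\<And>x. x \<in> V \<Longrightarrow> m x \<le> p x" "\<And>x. x \<notin> V \<Longrightarrow> m x = 0"
    unfolding A_def by auto
  have odd: "m (- y) = - m y" if y: "y \<in> V" for y
  proof -
    obtain r where r: "sublinear_on V r" "\<And>x. x \<in> V \<Longrightarrow> r x \<le> m x" "r (- y) \<le> - m y"
      using sublinear_on_decrease[OF V m(1) y] by blast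
    define a where "a x = (if x \<in> V then r x else 0)" for x
    have "sublinear_on V a"
      using r(1) V unfolding sublinear_on_def a_def by (simp add: subspace_add subspace_scale)
    then have "a \<in> A" unfolding A_def a_def using r(2) m(2) by fastforce
    moreover have "a \<le> m" unfolding a_def le_fun_def using r(2) m(3) by simp
    ultimately have "a = m" by (rule min)
    then have "m (- y) = r (- y)" using y V by (metis a_def subspace_neg)
    with r(3) have "m (- y) \<le> - m y" by simp
    with sublinear_on_minus_le[OF V m(1) y] show ?thesis by simp
  qed
  show ?thesis
  proof
    fix x y assume xy: "x \<in> V" "y \<in> V"
    have le: "m (u + v) \<le> m u + m v" if "u \<in> V" "v \<in> V" for u v
      using m(1) that unfolding sublinear_on_def by blast
    have "m x \<le> m (x + y) + m (- y)"
      using le[of "x + y" "- y"] xy V by (simp add: subspace_add subspace_neg)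
    with le[OF xy] odd[OF xy(2)] show "m (x + y) = m x + m y" by simp
  next
    fix c :: real and x assume x: "x \<in> V"
    have pos: "m (d *\<^sub>R x) = d * m x" if "d \<ge> 0" for d
      using m(1) that x unfolding sublinear_on_def by blast
    show "m (c *\<^sub>R x) = c * m x"
    proof (cases "c \<ge> 0")
      case False
      then have "m ((- c) *\<^sub>R x) = - c * m x" by (intro pos) simp
      moreover have "m ((- c) *\<^sub>R x) = - m (c *\<^sub>R x)"
        using odd[of "c *\<^sub>R x"] x V by (simp add: subspace_scale)
      ultimately show ?thesis by simp
    qed (rule pos)
  qed (rule m(2))
qed

text \<open>
  Decreasing the norm towards \<open>- N y\<close> at \<open>- y\<close> before the Hahn--Banach theorem is applied forces the
  value at \<open>y\<close>.
\<close>

lemma norming_functional: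
  assumes V: "subspace V" and N: "norm_on V N" and y: "y \<in> V"
  obtains f where "\<And>x z. x \<in> V \<Longrightarrow> z \<in> V \<Longrightarrow> f (x + z) = f x + f z"
    "\<And>c x. x \<in> V \<Longrightarrow> f (c *\<^sub>R x) = c * f x" "\<And>x. x \<in> V \<Longrightarrow> \<bar>f x\<bar> \<le> N x" "N y \<le> f y"
proof -
  obtain r where r: "sublinear_on V r" "\<And>x. x \<in> V \<Longrightarrow> r x \<le> N x" "r (- y) \<le> - N y"
    using sublinear_on_decrease[OF V norm_on_imp_sublinear_on[OF N] y] by blast
  obtain f where f: "\<And>x z. x \<in> V \<Longrightarrow> z \<in> V \<Longrightarrow> f (x + z) = f x + f z"
    "\<And>c x. x \<in> V \<Longrightarrow> f (c *\<^sub>R x) = c * f x" "\<And>x. x \<in> V \<Longrightarrow> f x \<le> r x"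
    using Hahn_Banach_sublinear[OF V r(1)] by blast
  have neg: "f (- x) = - f x" "N (- x) = N x" if "x \<in> V" for x
    using f(2)[of x "-1"] N that unfolding norm_on_def by (auto dest!: spec[of _ "-1"])
  have le: "f x \<le> N x" if "x \<in> V" for x
    using f(3)[OF that] r(2)[OF that] by simp
  show ?thesis
  proof
    show "\<bar>f x\<bar> \<le> N x" if "x \<in> V" for x
      using le[OF that] le[of "- x"] neg[OF that] that V by (simp add: subspace_neg abs_le_iff)
    show "N y \<le> f y"
      using f(3)[of "- y"] r(3) neg[OF y] y V by (simp add: subspace_neg)
  qed (use f in auto)
qed

section \<open>Weakly null sequences are bounded\<close>

text \<open>
  If \<open>N (x n)\<close> is unbounded, choose a selection \<open>y k\<close> of its terms with \<open>N (y k) > 4\<^sup>k\<close> and let \<open>g k\<close> norm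
  \<open>y k\<close>.  The series of the \<open>\<plusminus> 3\<^sup>-\<^sup>k g k\<close> converges to a bounded functional for every choice of signs.
  The \<open>k\<close>-th sign is chosen so that the new term does not cancel the partial sum before it at \<open>y k\<close>; then
  the partial sum has modulus at least \<open>3\<^sup>-\<^sup>k N (y k)\<close> there, while the tail after it contributes at most
  half of that.  So the limit functional has modulus at least \<open>(4/3)\<^sup>k / 2\<close> at \<open>y k\<close>, although weak
  convergence keeps its values on the sequence bounded.
\<close>

proposition weakly_null_on_bounded:
  assumes V: "subspace V" and N: "norm_on V N" and x: "weakly_null_on V N x"
  obtains M where "\<And>n. N (x n) \<le> M"
proof (rule ccontr)
  assume "\<not> thesis"
  with that have "\<forall>k::nat. \<exists>n. 4 ^ k < N (x n)" by (meson not_le)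
  then obtain s where s: "\<And>k. 4 ^ k < N (x (s k))" by metis
  define y where "y k = x (s k)" for k
  have yV: "y k \<in> V" for k using x unfolding weakly_null_on_def y_def by blast
  have "\<exists>f. (\<forall>u\<in>V. \<forall>v\<in>V. f (u + v) = f u + f v) \<and> (\<forall>c. \<forall>u\<in>V. f (c *\<^sub>R u) = c * f u) \<and>
      (\<forall>u\<in>V. \<bar>f u\<bar> \<le> N u) \<and> N (y k) \<le> f (y k)" for k
    using norming_functional[OF V N yV[of k]] by metis
  then obtain g where g: "\<And>k u v. u \<in> V \<Longrightarrow> v \<in> V \<Longrightarrow> g k (u + v) = g k u + g k v"
    "\<And>k c u. u \<in> V \<Longrightarrow> g k (c *\<^sub>R u) = c * g k u"
    "\<And>k u. u \<in> V \<Longrightarrow> \<bar>g k u\<bar> \<le> N u" "\<And>k. N (y k) \<le> g k (y k)"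
    by metis
  \<comment> \<open>The partial sums \<open>F\<close> have to be defined first, since each sign depends on the partial sum
    before it; \<open>c\<close> then collects the signed coefficients.\<close>
  define F where "F = rec_nat (\<lambda>_. 0)
    (\<lambda>k h z. h z + (if h (y k) \<ge> 0 then 1 else - 1) * (1 / 3) ^ k * g k z)"
  define c where "c k = (if F k (y k) \<ge> 0 then 1 else - 1) * (1 / 3 :: real) ^ k" for k
  have F_eq: "F k z = (\<Sum>j<k. c j * g j z)" for k z
    by (induction k) (simp_all add: F_def c_def)
  define f where "f z = (\<Sum>j. c j * g j z)" for z
  have term_le: "\<bar>c j * g j z\<bar> \<le> (1 / 3) ^ j * N z" if "z \<in> V" for j z
    using g(3)[OF that] by (auto simp: c_def abs_mult intro!: mult_left_mono)
  have geom: "(\<lambda>j. (1 / 3) ^ j * a) sums (3 / 2 * a)" for a :: real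
    using sums_mult2[OF geometric_sums[of "1 / 3 :: real"], of a] by simp
  have summ: "summable (\<lambda>j. c j * g j z)" if "z \<in> V" for z
    by (rule summable_comparison_test'[OF sums_summable[OF geom[of "N z"]], of 0])
       (use term_le[OF that] in simp)
  have "bounded_functional_on V N f"
    unfolding bounded_functional_on_def
  proof (intro conjI ballI allI exI)
    fix u v assume uv: "u \<in> V" "v \<in> V"
    show "f (u + v) = f u + f v"
      unfolding f_def using suminf_add[OF summ[OF uv(1)] summ[OF uv(2)]] uv
      by (simp add: g(1) distrib_left)
  next
    fix a u assume u: "u \<in> V"
    show "f (a *\<^sub>R u) = a * f u"
      unfolding f_def using suminf_mult[OF summ[OF u], of a] u by (simp add: g(2) mult.left_commute)
  next
    fix u assume u: "u \<in> V"
    have "\<bar>f u\<bar> \<le> (\<Sum>j. (1 / 3) ^ j * N u)"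
      unfolding f_def using norm_suminf_le[OF _ sums_summable[OF geom[of "N u"]], of "\<lambda>j. c j * g j u"] term_le[OF u]
      by simp
    then show "\<bar>f u\<bar> \<le> 3 / 2 * N u" using sums_unique[OF geom[of "N u"]] by simp
  qed
  then have "(\<lambda>n. f (x n)) \<longlonglongrightarrow> 0" using x unfolding weakly_null_on_def by blast
  then have "Bseq (\<lambda>n. f (x n))" by (intro convergent_imp_Bseq convergentI)
  then obtain K where K: "\<And>n. \<bar>f (x n)\<bar> \<le> K" by (auto simp: Bseq_def)
  have lower: "1 / 2 * (4 / 3) ^ k \<le> K" for k
  proof -
    have tail: "\<bar>\<Sum>j. c (j + Suc k) * g (j + Suc k) (y k)\<bar> \<le> 1 / 2 * (1 / 3) ^ k * N (y k)"
    proof -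
      have "\<bar>\<Sum>j. c (j + Suc k) * g (j + Suc k) (y k)\<bar> \<le> (\<Sum>j. (1 / 3) ^ j * ((1 / 3) ^ Suc k * N (y k)))"
        unfolding real_norm_def[symmetric]
      proof (rule norm_suminf_le[OF _ sums_summable[OF geom]])
        show "norm (c (j + Suc k) * g (j + Suc k) (y k)) \<le> (1 / 3) ^ j * ((1 / 3) ^ Suc k * N (y k))" for j
          using term_le[OF yV[of k], of "j + Suc k"] by (simp add: power_add mult.assoc)
      qed
      also have "\<dots> = 3 / 2 * ((1 / 3) ^ Suc k * N (y k))"
        using sums_unique[OF geom] by metis
      finally show ?thesis by (simp add: mult_ac)
    qed
    have "f (y k) = F (Suc k) (y k) + (\<Sum>j. c (j + Suc k) * g (j + Suc k) (y k))"
      unfolding f_def F_eq using suminf_split_initial_segment[OF summ[OF yV[of k]], of "Suc k"] by simp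
    moreover have "(1 / 3) ^ k * N (y k) \<le> \<bar>F (Suc k) (y k)\<bar>"
    proof -
      have "F (Suc k) (y k) = F k (y k) + c k * g k (y k)" by (simp add: F_eq)
      moreover have "c k * g k (y k) = (1 / 3) ^ k * g k (y k) \<and> 0 \<le> F k (y k) \<or>
          c k * g k (y k) = - ((1 / 3) ^ k * g k (y k)) \<and> F k (y k) < 0"
        by (auto simp: c_def)
      moreover have "(1 / 3) ^ k * N (y k) \<le> (1 / 3) ^ k * g k (y k)"
        using g(4) by (simp add: mult_left_mono)
      moreover have "0 \<le> (1 / 3) ^ k * N (y k)"
        using N yV unfolding norm_on_def by simp
      ultimately show ?thesis by linarith
    qed
    ultimately have "1 / 2 * (1 / 3) ^ k * N (y k) \<le> \<bar>f (y k)\<bar>" using tail by linarith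
    moreover have "1 / 2 * (1 / 3) ^ k * 4 ^ k \<le> 1 / 2 * (1 / 3) ^ k * N (y k)"
      using s[of k] by (intro mult_left_mono) (auto simp: y_def)
    moreover have "1 / 2 * (1 / 3) ^ k * 4 ^ k = 1 / 2 * (4 / 3 :: real) ^ k"
      by (simp add: power_divide)
    ultimately show ?thesis using K[of "s k"] unfolding y_def by linarith
  qed
  obtain k where "2 * K < (4 / 3) ^ k" using real_arch_pow[of "4 / 3" "2 * K"] by auto
  with lower[of k] show False by simp
qed

section \<open>The Opial properties as gap conditions\<close>

lemma limsup_bounded_real:
  fixes a :: "nat \<Rightarrow> real"
  assumes "\<And>n. 0 \<le> a n" "\<And>n. a n \<le> M"
  obtains L where "limsup (\<lambda>n. ereal (a n)) = ereal L"
proof -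
  have "limsup (\<lambda>n. ereal (a n)) \<le> ereal M"
    using assms by (intro Limsup_bounded) auto
  moreover have "ereal 0 \<le> limsup (\<lambda>n. ereal (a n))"
    using assms by (intro le_Limsup) auto
  ultimately show ?thesis using that by (cases "limsup (\<lambda>n. ereal (a n))") auto
qed

lemma limsup_add_le:
  fixes a b :: "nat \<Rightarrow> real"
  assumes "\<forall>\<^sub>F n in sequentially. a n + d \<le> b n"
  shows "limsup (\<lambda>n. ereal (a n)) + ereal d \<le> limsup (\<lambda>n. ereal (b n))"
proof -
  have "limsup (\<lambda>n. ereal (a n)) + ereal d = limsup (\<lambda>n. ereal (a n) + ereal d)"
    by (rule Limsup_add_ereal_right[symmetric]) auto
  also have "\<dots> \<le> limsup (\<lambda>n. ereal (b n))"
    using assms by (intro Limsup_mono) simp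
  finally show ?thesis .
qed

lemma ereal_le_add_of_add_uminus_le:
  "a + ereal (- e) \<le> b \<Longrightarrow> a \<le> b + ereal e"
  by (cases a; cases b) auto

lemma frequently_imp_subseq:
  assumes "\<And>k::nat. \<exists>\<^sub>F n in sequentially. P k n"
  obtains r :: "nat \<Rightarrow> nat" where "strict_mono r" "\<And>k. P k (r k)"
proof -
  have "\<exists>r. \<forall>k. P k (r k) \<and> r k < r (Suc k)"
  proof (rule dependent_nat_choice)
    show "\<exists>n. P 0 n" using assms frequently_ex by blast
    show "\<exists>n'. P (Suc k) n' \<and> n < n'" for n k
      using assms[of "Suc k"] unfolding frequently_sequentially by (meson Suc_le_lessD)
  qed
  then show ?thesis using that strict_mono_Suc_iff by blast
qed

lemma weakly_null_on_subseq:
  assumes "weakly_null_on V N y" "strict_mono r"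
  shows "weakly_null_on V N (\<lambda>k. y (r k))"
  using assms LIMSEQ_subseq_LIMSEQ[of "\<lambda>n. f (y n)" 0 r for f]
  unfolding weakly_null_on_def o_def by blast

text \<open>
  If no \<open>d\<close> works, then for every \<open>k\<close> there are infinitely many \<open>n\<close> at which the gap is below
  \<open>1 / (k + 1)\<close>.  Along a subsequence of such \<open>n\<close> the limits superior are in the wrong order.  In the
  converse direction a finite limit superior is needed, because adding \<open>d\<close> to infinity changes nothing.
\<close>

proposition opial_property_iff_gap:
  assumes V: "subspace V" and N: "norm_on V N"
  shows "opial_property V N \<longleftrightarrow> (\<forall>y x. weakly_null_on V N y \<longrightarrow> x \<in> V - {0} \<longrightarrow>
           (\<exists>d>0. \<forall>\<^sub>F n in sequentially. N (y n) + d \<le> N (y n - x)))"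
proof (intro iffI allI impI)
  fix y x assume op: "opial_property V N" and y: "weakly_null_on V N y" and x: "x \<in> V - {0}"
  show "\<exists>d>0. \<forall>\<^sub>F n in sequentially. N (y n) + d \<le> N (y n - x)"
  proof (rule ccontr)
    assume no_gap: "\<not> ?thesis"
    have "\<exists>\<^sub>F n in sequentially. N (y n - x) < N (y n) + 1 / real (Suc k)" for k
    proof -
      have "(0::real) < 1 / real (Suc k)" by simp
      with no_gap have "\<not> (\<forall>\<^sub>F n in sequentially. N (y n) + 1 / real (Suc k) \<le> N (y n - x))" by blast
      then show ?thesis by (simp add: not_eventually not_le)
    qed
    then obtain r where r: "strict_mono r" "\<And>k. N (y (r k) - x) < N (y (r k)) + 1 / real (Suc k)"
      using frequently_imp_subseq[of "\<lambda>k n. N (y n - x) < N (y n) + 1 / real (Suc k)"] by blast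
    have "limsup (\<lambda>k. ereal (N (y (r k) - x))) \<le> limsup (\<lambda>k. ereal (N (y (r k)))) + ereal e"
      if "e > 0" for e
    proof -
      have "\<forall>\<^sub>F k in sequentially. 1 / real (Suc k) < e"
        using order_tendstoD(2)[OF lim_1_over_n[THEN LIMSEQ_Suc]] that by fastforce
      then have "\<forall>\<^sub>F k in sequentially. N (y (r k) - x) + - e \<le> N (y (r k))"
      proof eventually_elim
        case (elim k)
        with r(2)[of k] show ?case by simp
      qed
      from limsup_add_le[OF this] show ?thesis
        by (rule ereal_le_add_of_add_uminus_le)
    qed
    then have "limsup (\<lambda>k. ereal (N (y (r k) - x))) \<le> limsup (\<lambda>k. ereal (N (y (r k))))"
      by (rule ereal_le_epsilon2)
    moreover have "limsup (\<lambda>k. ereal (N (y (r k)))) < limsup (\<lambda>k. ereal (N (y (r k) - x)))"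
      using op weakly_null_on_subseq[OF y r(1)] x unfolding opial_property_def by blast
    ultimately show False by simp
  qed
next
  assume gap: "\<forall>y x. weakly_null_on V N y \<longrightarrow> x \<in> V - {0} \<longrightarrow>
    (\<exists>d>0. \<forall>\<^sub>F n in sequentially. N (y n) + d \<le> N (y n - x))"
  show "opial_property V N"
    unfolding opial_property_def
  proof (intro allI impI)
    fix y x assume y: "weakly_null_on V N y" and x: "x \<in> V - {0}"
    then obtain d where d: "d > 0" "\<forall>\<^sub>F n in sequentially. N (y n) + d \<le> N (y n - x)"
      using gap by blast
    obtain M where M: "\<And>n. N (y n) \<le> M" using weakly_null_on_bounded[OF V N y] by blast
    have "0 \<le> N (y n)" for n using y N unfolding weakly_null_on_def norm_on_def by blast
    then obtain L where L: "limsup (\<lambda>n. ereal (N (y n))) = ereal L"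
      using limsup_bounded_real[of "\<lambda>n. N (y n)" M] M by blast
    have "ereal L < ereal L + ereal d" using d(1) by simp
    also have "\<dots> \<le> limsup (\<lambda>n. ereal (N (y n - x)))" using limsup_add_le[OF d(2)] L by simp
    finally show "limsup (\<lambda>n. ereal (N (y n))) < limsup (\<lambda>n. ereal (N (y n - x)))" using L by simp
  qed
qed

text \<open>
  Here boundedness is what makes the subsequence a counterexample: along it the limit superior drops by
  \<open>e\<close>, which contradicts the nonstrict property only if it is finite.
\<close>

proposition nonstrict_opial_property_iff_gap:
  assumes V: "subspace V" and N: "norm_on V N"
  shows "nonstrict_opial_property V N \<longleftrightarrow> (\<forall>y x. weakly_null_on V N y \<longrightarrow> x \<in> V - {0} \<longrightarrow>
           (\<forall>e>0. \<forall>\<^sub>F n in sequentially. N (y n) - e \<le> N (y n - x)))"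
proof (intro iffI allI impI)
  fix y x and e :: real
  assume op: "nonstrict_opial_property V N" and y: "weakly_null_on V N y" and x: "x \<in> V - {0}"
    and e: "e > 0"
  show "\<forall>\<^sub>F n in sequentially. N (y n) - e \<le> N (y n - x)"
  proof (rule ccontr)
    assume "\<not> ?thesis"
    then have "\<exists>\<^sub>F n in sequentially. N (y n - x) < N (y n) - e"
      by (simp add: not_eventually not_le)
    then obtain r where r: "strict_mono r" "\<And>k::nat. N (y (r k) - x) < N (y (r k)) - e"
      using frequently_imp_subseq[of "\<lambda>k n. N (y n - x) < N (y n) - e"] by blast
    have "limsup (\<lambda>k. ereal (N (y (r k) - x))) + ereal e \<le> limsup (\<lambda>k. ereal (N (y (r k))))"
      by (rule limsup_add_le) (use r(2) in \<open>simp add: less_imp_le less_diff_eq\<close>)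
    moreover have "limsup (\<lambda>k. ereal (N (y (r k)))) \<le> limsup (\<lambda>k. ereal (N (y (r k) - x)))"
      using op weakly_null_on_subseq[OF y r(1)] x unfolding nonstrict_opial_property_def by blast
    moreover obtain M where M: "\<And>n. N (y n) \<le> M"
      using weakly_null_on_bounded[OF V N y] by blast
    have "0 \<le> N (y n)" for n using y N unfolding weakly_null_on_def norm_on_def by blast
    then obtain L where L: "limsup (\<lambda>k. ereal (N (y (r k)))) = ereal L"
      using limsup_bounded_real[of "\<lambda>k. N (y (r k))" M] M by blast
    ultimately show False
      using e L by (cases "limsup (\<lambda>k. ereal (N (y (r k) - x)))") auto
  qed
next
  assume gap: "\<forall>y x. weakly_null_on V N y \<longrightarrow> x \<in> V - {0} \<longrightarrow>
    (\<forall>e>0. \<forall>\<^sub>F n in sequentially. N (y n) - e \<le> N (y n - x))"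
  show "nonstrict_opial_property V N"
    unfolding nonstrict_opial_property_def
  proof (intro allI impI, rule ereal_le_epsilon2)
    fix y x and e :: real
    assume y: "weakly_null_on V N y" and x: "x \<in> V - {0}" and e: "0 < e"
    then have "\<forall>\<^sub>F n in sequentially. N (y n) + - e \<le> N (y n - x)"
      using gap by simp
    from limsup_add_le[OF this]
    show "limsup (\<lambda>n. ereal (N (y n))) \<le> limsup (\<lambda>n. ereal (N (y n - x))) + ereal e"
      by (rule ereal_le_add_of_add_uminus_le)
  qed
qed

lemma opial_property_imp_nonstrict: "opial_property V N \<Longrightarrow> nonstrict_opial_property V N"
  unfolding opial_property_def nonstrict_opial_property_def by (blast intro: less_imp_le)

section \<open>Gaps between norms and between their powers\<close>

text \<open>
  Superadditivity of the \<open>p\<close>-th power: the factors \<open>a\<^sup>p\<^sup>-\<^sup>1\<close> and \<open>b\<^sup>p\<^sup>-\<^sup>1\<close> are at most \<open>(a + b)\<^sup>p\<^sup>-\<^sup>1\<close>.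
  It transfers the gap \<open>d\<close> between numbers to the gap \<open>d\<^sup>p\<close> between their powers, without any bound on
  the numbers.
\<close>

lemma powr_add_powr_le:
  fixes a b p :: real
  assumes "1 \<le> p" "0 \<le> a" "0 \<le> b"
  shows "a powr p + b powr p \<le> (a + b) powr p"
proof (cases "a + b = 0")
  case False
  with assms have s: "a + b > 0" by simp
  have part: "t powr p \<le> t * (a + b) powr (p - 1)" if "0 \<le> t" "t \<le> a + b" for t
  proof -
    have "t powr p = t * t powr (p - 1)" using that by (simp add: powr_mult_base)
    also have "\<dots> \<le> t * (a + b) powr (p - 1)"
      using that assms by (intro mult_left_mono powr_mono2) auto
    finally show ?thesis .
  qed
  have "a powr p + b powr p \<le> (a + b) * (a + b) powr (p - 1)"
    using part[of a] part[of b] assms by (simp add: distrib_right)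
  also have "\<dots> = (a + b) powr p" using s by (simp add: powr_mult_base)
  finally show ?thesis .
qed (use assms in \<open>simp add: add_nonneg_eq_0_iff\<close>)

text \<open>
  The two transfers that superadditivity does not give depend on a bound \<open>M\<close> and use uniform continuity
  of the power on a compact interval.
\<close>

lemma powr_gap_lower:
  fixes p M e :: real
  assumes "1 \<le> p" "0 < e"
  obtains h where "0 < h"
    "\<And>s t. 0 \<le> s \<Longrightarrow> s \<le> M \<Longrightarrow> 0 \<le> t \<Longrightarrow> t \<le> M \<Longrightarrow> s - h \<le> t \<Longrightarrow> s powr p - e \<le> t powr p"
proof -
  have "uniformly_continuous_on {0..M} (\<lambda>s. s powr p)"
    using assms by (intro compact_uniformly_continuous continuous_on_powr' continuous_intros) auto
  then obtain h where h: "0 < h" "\<And>s t. s \<in> {0..M} \<Longrightarrow> t \<in> {0..M} \<Longrightarrow> \<bar>t - s\<bar> < h \<Longrightarrow>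
      \<bar>t powr p - s powr p\<bar> < e"
    unfolding uniformly_continuous_on_def dist_real_def using assms(2) by meson
  show ?thesis
  proof
    show "0 < h / 2" using h(1) by simp
    fix s t assume st: "0 \<le> s" "s \<le> M" "0 \<le> t" "t \<le> M" "s - h / 2 \<le> t"
    show "s powr p - e \<le> t powr p"
    proof (cases "s \<le> t")
      case True
      then have "s powr p \<le> t powr p" using st assms by (intro powr_mono2) auto
      with assms show ?thesis by simp
    next
      case False
      with st h(1) have "\<bar>t - s\<bar> < h" by auto
      with h(2)[of s t] st show ?thesis by auto
    qed
  qed
qed

lemma powr_gap_root:
  fixes p M d :: real
  assumes "1 \<le> p" "0 < d"
  obtains h where "0 < h"
    "\<And>s t. 0 \<le> s \<Longrightarrow> s \<le> M \<Longrightarrow> 0 \<le> t \<Longrightarrow> s powr p + d \<le> t powr p \<Longrightarrow> s + h \<le> t"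
proof -
  obtain k where k: "0 < k" "\<And>s t. 0 \<le> s \<Longrightarrow> s \<le> M + 1 \<Longrightarrow> 0 \<le> t \<Longrightarrow> t \<le> M + 1 \<Longrightarrow>
      s - k \<le> t \<Longrightarrow> s powr p - d / 2 \<le> t powr p"
    using powr_gap_lower[of p "d / 2" "M + 1"] assms by auto
  show ?thesis
  proof
    \<comment> \<open>A hypothetical \<open>t < s + h\<close> must lie in the interval to which \<open>k\<close> refers, hence \<open>h \<le> 1\<close>.\<close>
    show "0 < min k 1" using k(1) by simp
    fix s t assume st: "0 \<le> s" "s \<le> M" "0 \<le> t" "s powr p + d \<le> t powr p"
    show "s + min k 1 \<le> t"
    proof (rule ccontr)
      assume "\<not> ?thesis"
      with k(2)[of t s] st have "t powr p - d / 2 \<le> s powr p" by auto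
      with st assms(2) show False by simp
    qed
  qed
qed

lemma powr_le_imp_diff_le:
  fixes p s t h :: real
  assumes "1 \<le> p" "0 \<le> t" "0 < h" "s powr p - h powr p \<le> t powr p"
  shows "s - h \<le> t"
proof (rule ccontr)
  assume "\<not> ?thesis"
  then have "(t + h) powr p < s powr p" using assms by (intro powr_less_mono2) auto
  with powr_add_powr_le[of p t h] assms show False by simp
qed

lemma norm_on_nonneg: "norm_on V N \<Longrightarrow> x \<in> V \<Longrightarrow> 0 \<le> N x"
  unfolding norm_on_def by blast

lemma norm_on_zero: "subspace V \<Longrightarrow> norm_on V N \<Longrightarrow> N 0 = 0"
  unfolding norm_on_def by (simp add: subspace_0)

lemma opial_gap_powr:
  assumes V: "subspace V" and N: "norm_on V N" and op: "opial_property V N" and p: "1 \<le> p"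
    and y: "weakly_null_on V N y" and x: "x \<in> V - {0}"
  obtains d where "0 < d" "\<forall>\<^sub>F n in sequentially. N (y n) powr p + d \<le> N (y n - x) powr p"
proof -
  obtain d where d: "0 < d" "\<forall>\<^sub>F n in sequentially. N (y n) + d \<le> N (y n - x)"
    using op y x unfolding opial_property_iff_gap[OF V N] by blast
  have "\<forall>\<^sub>F n in sequentially. N (y n) powr p + d powr p \<le> N (y n - x) powr p"
    using d(2)
  proof eventually_elim
    case (elim n)
    have n: "0 \<le> N (y n)" using norm_on_nonneg[OF N] y unfolding weakly_null_on_def by blast
    then have "N (y n) powr p + d powr p \<le> (N (y n) + d) powr p"
      using d(1) p by (intro powr_add_powr_le) auto
    also have "\<dots> \<le> N (y n - x) powr p" using elim d(1) p n by (intro powr_mono2) auto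
    finally show ?case .
  qed
  with d(1) show ?thesis by (intro that[of "d powr p"]) auto
qed

lemma nonstrict_opial_gap_powr:
  assumes V: "subspace V" and N: "norm_on V N" and op: "nonstrict_opial_property V N"
    and p: "1 \<le> p" and y: "weakly_null_on V N y" and x: "x \<in> V" and e: "0 < e"
  shows "\<forall>\<^sub>F n in sequentially. N (y n) powr p - e \<le> N (y n - x) powr p"
proof (cases "x = 0")
  case False
  obtain M where M: "\<And>n. N (y n) \<le> M" using weakly_null_on_bounded[OF V N y] by blast
  have yV: "y n \<in> V" for n using y unfolding weakly_null_on_def by blast
  obtain h where h: "0 < h" "\<And>s t. 0 \<le> s \<Longrightarrow> s \<le> M + N x \<Longrightarrow> 0 \<le> t \<Longrightarrow> t \<le> M + N x \<Longrightarrow>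
      s - h \<le> t \<Longrightarrow> s powr p - e \<le> t powr p"
    using powr_gap_lower[OF p e] by metis
  have "\<forall>\<^sub>F n in sequentially. N (y n) - h \<le> N (y n - x)"
    using op y x False h(1) unfolding nonstrict_opial_property_iff_gap[OF V N] by blast
  then show ?thesis
  proof eventually_elim
    case (elim n)
    have "N (y n - x) \<le> N (y n) + N ((- 1) *\<^sub>R x)"
      using N yV[of n] x V unfolding norm_on_def
      by (metis diff_conv_add_uminus scaleR_minus1_left subspace_neg)
    also have "N ((- 1) *\<^sub>R x) = \<bar>- 1\<bar> * N x" using N x unfolding norm_on_def by blast
    finally have "N (y n - x) \<le> M + N x" using M[of n] by simp
    moreover have "N (y n) \<le> M + N x" using M[of n] norm_on_nonneg[OF N x] by simp
    ultimately show ?case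
      using elim h(2) norm_on_nonneg[OF N] yV x V by (meson subspace_diff)
  qed
qed (use e in simp)

section \<open>Minkowski's inequality for infinite sums\<close>

text \<open>
  Convexity of the \<open>p\<close>-th power at \<open>a / s\<close> and \<open>b / t\<close>, with the weights \<open>s\<close> and \<open>t\<close>.
\<close>

lemma powr_add_le_weighted:
  fixes a b p s t :: real
  assumes p: "1 \<le> p" and ab: "0 \<le> a" "0 \<le> b" and st: "0 < s" "0 < t" "s + t = 1"
  shows "(a + b) powr p \<le> s powr (1 - p) * a powr p + t powr (1 - p) * b powr p"
proof -
  have ge1: "1 \<le> u powr (1 - p)" if "0 < u" "u \<le> 1" for u
    using powr_mono2'[of "1 - p" u 1] that p by simp
  consider "a = 0" | "b = 0" | "0 < a" "0 < b" using ab by fastforce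
  then show ?thesis
  proof cases
    case 3
    have split: "u * (c / u) powr p = u powr (1 - p) * c powr p" if "0 < u" "0 < c" for u c
      using that by (simp add: powr_divide powr_diff)
    have s: "s = 1 - t" using st by simp
    have "(a + b) powr p = (s *\<^sub>R (a / s) + t *\<^sub>R (b / t)) powr p" using st by simp
    also have "\<dots> \<le> s * (a / s) powr p + t * (b / t) powr p"
      unfolding s
      by (rule convex_onD[OF powr_convex[OF p]]) (use 3 st in \<open>auto simp flip: s\<close>)
    finally show ?thesis using split 3 st by simp
  next
    case 1
    then show ?thesis using ge1[of t] st p mult_right_mono[of 1 "t powr (1 - p)" "b powr p"] by simp
  next
    case 2
    then show ?thesis using ge1[of s] st p mult_right_mono[of 1 "s powr (1 - p)" "a powr p"] by simp
  qed
qed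

text \<open>
  Let \<open>A\<close> and \<open>B\<close> be the norms of \<open>a\<close> and \<open>b\<close>.  Summing the weighted inequality with
  \<open>s = A / (A + B)\<close> and \<open>t = B / (A + B)\<close> bounds the \<open>p\<close>-th power of the left side by
  \<open>A (A + B)\<^sup>p\<^sup>-\<^sup>1 + B (A + B)\<^sup>p\<^sup>-\<^sup>1 = (A + B)\<^sup>p\<close>.  Since the weights must be positive, the proof
  takes arbitrary \<open>A\<close> and \<open>B\<close> strictly above the norms and lets them tend to the norms at the end.
\<close>

lemma
  fixes a b :: "'i \<Rightarrow> real"
  assumes p: "1 \<le> p" and nonneg: "\<And>i. i \<in> I \<Longrightarrow> 0 \<le> a i" "\<And>i. i \<in> I \<Longrightarrow> 0 \<le> b i"
    and summ: "(\<lambda>i. a i powr p) summable_on I" "(\<lambda>i. b i powr p) summable_on I"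
  shows summable_on_powr_add: "(\<lambda>i. (a i + b i) powr p) summable_on I" (is ?summ)
    and Minkowski_infsum: "(\<Sum>\<^sub>\<infinity>i\<in>I. (a i + b i) powr p) powr (1 / p)
      \<le> (\<Sum>\<^sub>\<infinity>i\<in>I. a i powr p) powr (1 / p) + (\<Sum>\<^sub>\<infinity>i\<in>I. b i powr p) powr (1 / p)" (is ?le)
proof -
  have weighted_summ: "(\<lambda>i. c * a i powr p + d * b i powr p) summable_on I" for c d
    by (intro summable_on_add summable_on_cmult_right summ)
  show s: ?summ
    using weighted_summ
    by (rule summable_on_comparison_test)
       (use nonneg p in \<open>auto intro!: powr_add_le_weighted[of p _ _ "1 / 2" "1 / 2"]\<close>)
  define norm_a norm_b where "norm_a = (\<Sum>\<^sub>\<infinity>i\<in>I. a i powr p) powr (1 / p)"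
    and "norm_b = (\<Sum>\<^sub>\<infinity>i\<in>I. b i powr p) powr (1 / p)"
  have le: "(\<Sum>\<^sub>\<infinity>i\<in>I. (a i + b i) powr p) powr (1 / p) \<le> A + B"
    if A: "norm_a < A" and B: "norm_b < B" for A B
  proof -
    have pos: "0 < A" "0 < B"
      using A B powr_ge_zero unfolding norm_a_def norm_b_def by (meson le_less_trans)+
    have "(\<Sum>\<^sub>\<infinity>i\<in>I. a i powr p) = norm_a powr p"
      using p by (simp add: norm_a_def powr_powr infsum_nonneg)
    also have "\<dots> \<le> A powr p" using A p by (intro powr_mono2) (auto simp: norm_a_def)
    finally have a_le: "(\<Sum>\<^sub>\<infinity>i\<in>I. a i powr p) \<le> A powr p" .
    have "(\<Sum>\<^sub>\<infinity>i\<in>I. b i powr p) = norm_b powr p"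
      using p by (simp add: norm_b_def powr_powr infsum_nonneg)
    also have "\<dots> \<le> B powr p" using B p by (intro powr_mono2) (auto simp: norm_b_def)
    finally have b_le: "(\<Sum>\<^sub>\<infinity>i\<in>I. b i powr p) \<le> B powr p" .
    define s t where "s = A / (A + B)" and "t = B / (A + B)"
    have st: "0 < s" "0 < t" "s + t = 1" using pos by (auto simp: s_def t_def simp flip: add_divide_distrib)
    have weight: "(u / (A + B)) powr (1 - p) * u powr p = u * (A + B) powr (p - 1)" if "0 < u" for u
      using that pos by (simp add: powr_divide powr_diff)
    have "(\<Sum>\<^sub>\<infinity>i\<in>I. (a i + b i) powr p)
        \<le> (\<Sum>\<^sub>\<infinity>i\<in>I. s powr (1 - p) * a i powr p + t powr (1 - p) * b i powr p)"
      using nonneg p st by (intro infsum_mono s weighted_summ powr_add_le_weighted) auto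
    also have "\<dots> = s powr (1 - p) * (\<Sum>\<^sub>\<infinity>i\<in>I. a i powr p) + t powr (1 - p) * (\<Sum>\<^sub>\<infinity>i\<in>I. b i powr p)"
      by (subst infsum_add) (auto intro!: summable_on_cmult_right summ simp: infsum_cmult_right')
    also have "\<dots> \<le> s powr (1 - p) * A powr p + t powr (1 - p) * B powr p"
      using a_le b_le by (intro add_mono mult_left_mono) auto
    also have "\<dots> = (A + B) powr p"
      unfolding s_def t_def weight[OF pos(1)] weight[OF pos(2)]
      using pos by (simp add: powr_mult_base flip: distrib_right)
    finally have "(\<Sum>\<^sub>\<infinity>i\<in>I. (a i + b i) powr p) powr (1 / p) \<le> ((A + B) powr p) powr (1 / p)"
      using p by (intro powr_mono2) (auto intro!: infsum_nonneg)
    also have "\<dots> = A + B" using p pos by (simp add: powr_powr)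
    finally show ?thesis .
  qed
  have "(\<Sum>\<^sub>\<infinity>i\<in>I. (a i + b i) powr p) powr (1 / p) \<le> norm_a + norm_b"
  proof (rule field_le_epsilon)
    fix e :: real assume "e > 0"
    then show "(\<Sum>\<^sub>\<infinity>i\<in>I. (a i + b i) powr p) powr (1 / p) \<le> norm_a + norm_b + e"
      using le[of "norm_a + e / 2" "norm_b + e / 2"] by simp
  qed
  then show ?le unfolding norm_a_def norm_b_def .
qed

section \<open>The \<open>\<ell>\<^sup>p\<close>-sum as a normed space\<close>

lemma lp_sum_norm_powr:
  assumes "1 \<le> p"
  shows "lp_sum_norm p I N x powr p = (\<Sum>\<^sub>\<infinity>i\<in>I. N i (x i) powr p)"
  using assms by (simp add: lp_sum_norm_def powr_powr infsum_nonneg)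

lemma lp_sum_norm_nonneg: "0 \<le> lp_sum_norm p I N x"
  by (simp add: lp_sum_norm_def)

lemma lp_sum_component: "x \<in> lp_sum p I V N \<Longrightarrow> i \<in> I \<Longrightarrow> x i \<in> V i"
  by (simp add: lp_sum_def)

lemma norm_le_lp_sum_norm:
  assumes p: "1 \<le> p" and N: "norm_on (V i) (N i)" and i: "i \<in> I" and x: "x \<in> lp_sum p I V N"
  shows "N i (x i) \<le> lp_sum_norm p I N x"
proof -
  have "N i (x i) powr p = (\<Sum>j\<in>{i}. N j (x j) powr p)" by simp
  also have "\<dots> \<le> (\<Sum>\<^sub>\<infinity>j\<in>I. N j (x j) powr p)"
    using x i by (intro finite_sum_le_infsum) (auto simp: lp_sum_def)
  finally have "(N i (x i) powr p) powr (1 / p) \<le> lp_sum_norm p I N x"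
    unfolding lp_sum_norm_def using p by (intro powr_mono2) auto
  then show ?thesis
    using p norm_on_nonneg[OF N lp_sum_component[OF x i]] by (simp add: powr_powr)
qed

context
  fixes p :: real and I :: "'i set" and V :: "'i \<Rightarrow> 'b::real_vector set" and N :: "'i \<Rightarrow> 'b \<Rightarrow> real"
  assumes p: "1 \<le> p"
    and V: "\<And>i. i \<in> I \<Longrightarrow> subspace (V i)"
    and N: "\<And>i. i \<in> I \<Longrightarrow> norm_on (V i) (N i)"
begin

lemma lp_sum_add:
  assumes x: "x \<in> lp_sum p I V N" and y: "y \<in> lp_sum p I V N"
  shows "x + y \<in> lp_sum p I V N"
    and "lp_sum_norm p I N (x + y) \<le> lp_sum_norm p I N x + lp_sum_norm p I N y"
proof -
  have xy: "x i \<in> V i" "y i \<in> V i" "0 \<le> N i (x i)" "0 \<le> N i (y i)"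
    "0 \<le> N i (x i + y i)" "N i (x i + y i) \<le> N i (x i) + N i (y i)" if "i \<in> I" for i
    using lp_sum_component[OF x that] lp_sum_component[OF y that] V[OF that] N[OF that]
    by (auto simp: norm_on_def subspace_add)
  have summ: "(\<lambda>i. (N i (x i) + N i (y i)) powr p) summable_on I"
    using x y xy by (intro summable_on_powr_add[OF p]) (auto simp: lp_sum_def)
  have summ': "(\<lambda>i. N i (x i + y i) powr p) summable_on I"
    by (rule summable_on_comparison_test[OF summ]) (use xy p in \<open>auto intro!: powr_mono2\<close>)
  then show "x + y \<in> lp_sum p I V N"
    using x y xy V by (auto simp: lp_sum_def intro: subspace_add)
  have "lp_sum_norm p I N (x + y) \<le> (\<Sum>\<^sub>\<infinity>i\<in>I. (N i (x i) + N i (y i)) powr p) powr (1 / p)"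
    unfolding lp_sum_norm_def plus_fun_apply
    using xy p by (intro powr_mono2 infsum_mono summ summ' infsum_nonneg) auto
  also have "\<dots> \<le> lp_sum_norm p I N x + lp_sum_norm p I N y"
    unfolding lp_sum_norm_def
    using x y xy by (intro Minkowski_infsum[OF p]) (auto simp: lp_sum_def)
  finally show "lp_sum_norm p I N (x + y) \<le> lp_sum_norm p I N x + lp_sum_norm p I N y" .
qed

lemma lp_sum_scaleR:
  assumes x: "x \<in> lp_sum p I V N"
  shows "c *\<^sub>R x \<in> lp_sum p I V N"
    and "lp_sum_norm p I N (c *\<^sub>R x) = \<bar>c\<bar> * lp_sum_norm p I N x"
proof -
  have eq: "N i ((c *\<^sub>R x) i) powr p = \<bar>c\<bar> powr p * N i (x i) powr p" if "i \<in> I" for i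
  proof -
    have "N i (c *\<^sub>R x i) = \<bar>c\<bar> * N i (x i)"
      using N[OF that] lp_sum_component[OF x that] unfolding norm_on_def by blast
    then show ?thesis
      using norm_on_nonneg[OF N[OF that] lp_sum_component[OF x that]]
      by (simp add: scaleR_fun_def powr_mult)
  qed
  have "(\<lambda>i. \<bar>c\<bar> powr p * N i (x i) powr p) summable_on I"
    using x by (intro summable_on_cmult_right) (auto simp: lp_sum_def)
  then have "(\<lambda>i. N i ((c *\<^sub>R x) i) powr p) summable_on I"
    using eq by (simp cong: summable_on_cong)
  then show "c *\<^sub>R x \<in> lp_sum p I V N"
    using x V unfolding lp_sum_def by (auto simp: scaleR_fun_def intro: subspace_scale)
  have "(\<Sum>\<^sub>\<infinity>i\<in>I. N i ((c *\<^sub>R x) i) powr p) = \<bar>c\<bar> powr p * (\<Sum>\<^sub>\<infinity>i\<in>I. N i (x i) powr p)"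
    using eq by (simp add: infsum_cmult_right' cong: infsum_cong)
  then show "lp_sum_norm p I N (c *\<^sub>R x) = \<bar>c\<bar> * lp_sum_norm p I N x"
    using p by (simp add: lp_sum_norm_def powr_mult powr_powr infsum_nonneg)
qed

lemma subspace_lp_sum: "subspace (lp_sum p I V N)"
proof (rule subspaceI)
  have "(\<lambda>i. N i 0 powr p) summable_on I \<longleftrightarrow> (\<lambda>i. 0 :: real) summable_on I"
    using norm_on_zero[OF V N] by (intro summable_on_cong) simp
  then show "0 \<in> lp_sum p I V N" using V by (auto simp: lp_sum_def subspace_0)
qed (use lp_sum_add lp_sum_scaleR in auto)

lemma norm_on_lp_sum: "norm_on (lp_sum p I V N) (lp_sum_norm p I N)"
  unfolding norm_on_def
proof (intro conjI ballI allI)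
  fix x assume x: "x \<in> lp_sum p I V N"
  show "0 \<le> lp_sum_norm p I N x" by (simp add: lp_sum_norm_def)
  show "lp_sum_norm p I N x = 0 \<longleftrightarrow> x = 0"
  proof
    assume "lp_sum_norm p I N x = 0"
    then have "N i (x i) = 0" if "i \<in> I" for i
      using norm_le_lp_sum_norm[OF p N[OF that] that x]
        norm_on_nonneg[OF N[OF that] lp_sum_component[OF x that]] by simp
    then have "x i = 0" if "i \<in> I" for i
      using N[OF that] lp_sum_component[OF x that] that unfolding norm_on_def by blast
    with x show "x = 0" by (auto simp: lp_sum_def fun_eq_iff)
  next
    assume "x = 0"
    then have "lp_sum_norm p I N x = (\<Sum>\<^sub>\<infinity>i\<in>I. (0::real)) powr (1 / p)"
      unfolding lp_sum_norm_def using norm_on_zero[OF V N]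
      by (intro arg_cong2[where f = "(powr)"] infsum_cong) auto
    then show "lp_sum_norm p I N x = 0" by simp
  qed
qed (use lp_sum_add lp_sum_scaleR in auto)

text \<open>
  The coordinate projections have norm at most one, so a bounded functional on a summand composed with
  the projection is a bounded functional on the sum.
\<close>

lemma weakly_null_on_component:
  assumes y: "weakly_null_on (lp_sum p I V N) (lp_sum_norm p I N) y" and i: "i \<in> I"
  shows "weakly_null_on (V i) (N i) (\<lambda>n. y n i)"
  unfolding weakly_null_on_def
proof (intro conjI allI impI)
  fix n
  have "y n \<in> lp_sum p I V N" using y unfolding weakly_null_on_def by blast
  then show "y n i \<in> V i" using i by (rule lp_sum_component)
next
  fix f assume f: "bounded_functional_on (V i) (N i) f"
  then obtain K where K: "\<And>u. u \<in> V i \<Longrightarrow> \<bar>f u\<bar> \<le> K * N i u"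
    unfolding bounded_functional_on_def by blast
  have "\<bar>f (x i)\<bar> \<le> \<bar>K\<bar> * lp_sum_norm p I N x" if x: "x \<in> lp_sum p I V N" for x
  proof -
    have "\<bar>f (x i)\<bar> \<le> K * N i (x i)" by (rule K[OF lp_sum_component[OF x i]])
    also have "\<dots> \<le> \<bar>K\<bar> * N i (x i)"
      using norm_on_nonneg[OF N[OF i] lp_sum_component[OF x i]] by (intro mult_right_mono) auto
    also have "\<dots> \<le> \<bar>K\<bar> * lp_sum_norm p I N x"
      by (intro mult_left_mono norm_le_lp_sum_norm[OF p N[OF i] i x]) auto
    finally show ?thesis .
  qed
  moreover have "x i \<in> V i" if "x \<in> lp_sum p I V N" for x
    using that i by (rule lp_sum_component)
  ultimately have "bounded_functional_on (lp_sum p I V N) (lp_sum_norm p I N) (\<lambda>x. f (x i))"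
    using f unfolding bounded_functional_on_def by (auto simp: scaleR_fun_def)
  then show "(\<lambda>n. f (y n i)) \<longlonglongrightarrow> 0" using y unfolding weakly_null_on_def by blast
qed

section \<open>Cutting down to finitely many coordinates\<close>

lemma restrict_in_lp_sum:
  assumes x: "x \<in> lp_sum p I V N"
  shows "(\<lambda>i. if i \<in> F then x i else 0) \<in> lp_sum p I V N"
proof -
  have x': "(\<lambda>i. N i (x i) powr p) summable_on I" using x by (simp add: lp_sum_def)
  have "(\<lambda>i. N i (if i \<in> F then x i else 0) powr p) summable_on I"
    by (rule summable_on_comparison_test[OF x']) (use norm_on_zero[OF V N] in auto)
  with x V show ?thesis by (auto simp: lp_sum_def subspace_0)
qed

text \<open>
  The \<open>p\<close>-th powers of the two norms are sums whose terms differ only on \<open>F\<close>.  For \<open>y = x\<close> this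
  computes the error of the approximation of \<open>x\<close> by its restriction; for \<open>y\<close> a term of a weakly null
  sequence it reduces the gap in the sum to gaps in finitely many coordinates.
\<close>

lemma lp_sum_norm_diff_restrict:
  assumes x: "x \<in> lp_sum p I V N" and y: "y \<in> lp_sum p I V N" and F: "finite F" "F \<subseteq> I"
  shows "lp_sum_norm p I N (y - (\<lambda>i. if i \<in> F then x i else 0)) powr p =
    lp_sum_norm p I N y powr p + (\<Sum>i\<in>F. N i (y i - x i) powr p - N i (y i) powr p)"
proof -
  define z where "z = y - (\<lambda>i. if i \<in> F then x i else 0)"
  define D where "D i = N i (z i) powr p - N i (y i) powr p" for i
  have "(D has_sum sum D F) I"
    by (rule has_sum_finite_neutralI) (use F in \<open>auto simp: D_def z_def\<close>)
  moreover have "(\<lambda>i. N i (y i) powr p) summable_on I" using y by (simp add: lp_sum_def)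
  ultimately have "(\<Sum>\<^sub>\<infinity>i\<in>I. N i (y i) powr p + D i) = (\<Sum>\<^sub>\<infinity>i\<in>I. N i (y i) powr p) + sum D F"
    by (intro infsumI has_sum_add has_sum_infsum)
  then have "lp_sum_norm p I N z powr p = lp_sum_norm p I N y powr p + sum D F"
    by (simp add: lp_sum_norm_powr[OF p] D_def)
  then show ?thesis by (simp add: z_def D_def)
qed

text \<open>
  The set \<open>G\<close> is for coordinates that have to be kept whatever the accuracy: in the strict case, the one
  that carries the gap.
\<close>

lemma lp_sum_approx_restrict:
  assumes x: "x \<in> lp_sum p I V N" and G: "finite G" "G \<subseteq> I" and e: "0 < e"
  obtains F where "finite F" "G \<subseteq> F" "F \<subseteq> I"
    "lp_sum_norm p I N (x - (\<lambda>i. if i \<in> F then x i else 0)) < e"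
proof -
  have "(\<lambda>i. N i (x i) powr p) summable_on I" using x by (simp add: lp_sum_def)
  from infsum_tendsto[OF this]
  have "\<forall>\<^sub>F F in finite_subsets_at_top I.
      lp_sum_norm p I N x powr p - e powr p < (\<Sum>i\<in>F. N i (x i) powr p)"
    using e by (intro order_tendstoD(1)) (auto simp: lp_sum_norm_powr[OF p])
  then obtain F0 where F0: "finite F0" "F0 \<subseteq> I" "\<forall>F. finite F \<and> F0 \<subseteq> F \<and> F \<subseteq> I \<longrightarrow>
      lp_sum_norm p I N x powr p - e powr p < (\<Sum>i\<in>F. N i (x i) powr p)"
    unfolding eventually_finite_subsets_at_top by (elim exE conjE)
  define F where "F = F0 \<union> G"
  have F: "finite F" "G \<subseteq> F" "F \<subseteq> I" using F0 G by (auto simp: F_def)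
  have "(\<Sum>i\<in>F. N i (x i - x i) powr p - N i (x i) powr p) = - (\<Sum>i\<in>F. N i (x i) powr p)"
    using norm_on_zero[OF V N] F(3) unfolding sum_negf[symmetric] by (intro sum.cong) auto
  then have "lp_sum_norm p I N (x - (\<lambda>i. if i \<in> F then x i else 0)) powr p < e powr p"
    using F0(3)[rule_format, of F] F unfolding lp_sum_norm_diff_restrict[OF x x F(1,3)]
    by (simp add: F_def)
  then have "lp_sum_norm p I N (x - (\<lambda>i. if i \<in> F then x i else 0)) < e"
    using e p powr_mono2[of p e "lp_sum_norm p I N (x - (\<lambda>i. if i \<in> F then x i else 0))"]
    by linarith
  with F show ?thesis by (rule that)
qed

text \<open>
  The \<open>d i\<close> may have either sign: a positive one is a gap, a negative one a tolerated loss.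
\<close>

lemma lp_sum_gap:
  assumes y: "\<And>n. y n \<in> lp_sum p I V N" and x: "x \<in> lp_sum p I V N" and F: "finite F" "F \<subseteq> I"
    and gap: "\<And>i. i \<in> F \<Longrightarrow>
      \<forall>\<^sub>F n in sequentially. N i (y n i) powr p + d i \<le> N i (y n i - x i) powr p"
    and d: "c \<le> sum d F"
  shows "\<forall>\<^sub>F n in sequentially. lp_sum_norm p I N (y n) powr p + c
    \<le> lp_sum_norm p I N (y n - (\<lambda>i. if i \<in> F then x i else 0)) powr p"
proof -
  have "\<forall>\<^sub>F n in sequentially. \<forall>i\<in>F. N i (y n i) powr p + d i \<le> N i (y n i - x i) powr p"
    using gap F(1) by (intro eventually_ball_finite) auto
  then show ?thesis
  proof eventually_elim
    case (elim n)
    then have "sum d F \<le> (\<Sum>i\<in>F. N i (y n i - x i) powr p - N i (y n i) powr p)"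
      by (intro sum_mono) (simp add: algebra_simps)
    with d show ?case unfolding lp_sum_norm_diff_restrict[OF x y F] by simp
  qed
qed

lemma lp_sum_norm_diff_le:
  assumes "y \<in> lp_sum p I V N" "x \<in> lp_sum p I V N" "x' \<in> lp_sum p I V N"
  shows "lp_sum_norm p I N (y - x') \<le> lp_sum_norm p I N (y - x) + lp_sum_norm p I N (x - x')"
proof -
  have "(y - x) + (x - x') = y - x'" by (simp add: fun_eq_iff)
  moreover have "lp_sum_norm p I N ((y - x) + (x - x'))
      \<le> lp_sum_norm p I N (y - x) + lp_sum_norm p I N (x - x')"
    by (intro lp_sum_add(2) subspace_diff[OF subspace_lp_sum] assms)
  ultimately show ?thesis by (simp only:)
qed

section \<open>The Opial properties of the sum\<close>

proposition nonstrict_opial_property_lp_sum: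
  assumes op: "\<And>i. i \<in> I \<Longrightarrow> nonstrict_opial_property (V i) (N i)"
  shows "nonstrict_opial_property (lp_sum p I V N) (lp_sum_norm p I N)"
  unfolding nonstrict_opial_property_iff_gap[OF subspace_lp_sum norm_on_lp_sum]
proof (intro allI impI)
  fix y x and e :: real
  assume y: "weakly_null_on (lp_sum p I V N) (lp_sum_norm p I N) y"
    and x: "x \<in> lp_sum p I V N - {0}" and e: "0 < e"
  have yn: "y n \<in> lp_sum p I V N" for n using y unfolding weakly_null_on_def by blast
  have x': "x \<in> lp_sum p I V N" using x by blast
  obtain F where F: "finite F" "F \<subseteq> I"
    "lp_sum_norm p I N (x - (\<lambda>i. if i \<in> F then x i else 0)) < e / 2"
    using lp_sum_approx_restrict[OF x', of "{}" "e / 2"] e by auto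
  \<comment> \<open>The total loss over \<open>F\<close> in the powers is to be at most \<open>(e / 2)\<^sup>p\<close>, which costs at most \<open>e / 2\<close>
    in the norms; the other \<open>e / 2\<close> pays for the restriction.  The \<open>+ 1\<close> covers empty \<open>F\<close>.\<close>
  define d where "d = (e / 2) powr p / (real (card F) + 1)"
  have d_pos: "0 < d" using e by (simp add: d_def add_nonneg_pos)
  have "(real (card F) + 1) * d = (e / 2) powr p" by (simp add: d_def)
  with d_pos have d_sum: "- ((e / 2) powr p) \<le> (\<Sum>i\<in>F. - d)" by (simp add: distrib_right)
  have "\<forall>\<^sub>F n in sequentially. lp_sum_norm p I N (y n) powr p + - ((e / 2) powr p)
      \<le> lp_sum_norm p I N (y n - (\<lambda>i. if i \<in> F then x i else 0)) powr p"
  proof (rule lp_sum_gap[OF yn x' F(1,2) _ d_sum])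
    fix i assume "i \<in> F"
    then have i: "i \<in> I" using F(2) by blast
    show "\<forall>\<^sub>F n in sequentially. N i (y n i) powr p + - d \<le> N i (y n i - x i) powr p"
      using nonstrict_opial_gap_powr[OF V[OF i] N[OF i] op[OF i] p
          weakly_null_on_component[OF y i] lp_sum_component[OF x' i] d_pos] by simp
  qed
  then show "\<forall>\<^sub>F n in sequentially. lp_sum_norm p I N (y n) - e \<le> lp_sum_norm p I N (y n - x)"
  proof eventually_elim
    case (elim n)
    have "lp_sum_norm p I N (y n) - e / 2
        \<le> lp_sum_norm p I N (y n - (\<lambda>i. if i \<in> F then x i else 0))"
      by (rule powr_le_imp_diff_le[OF p lp_sum_norm_nonneg]) (use elim e in simp_all)
    with lp_sum_norm_diff_le[OF yn x' restrict_in_lp_sum[OF x'], of n F] F(3) show ?case by simp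
  qed
qed

text \<open>
  The order of the choices matters: first the coordinate \<open>j\<close>, whose gap \<open>d\<close> determines a gap \<open>h\<close> for the
  norms in the sum; then \<open>F\<close>, such that the restriction of \<open>x\<close> to \<open>F\<close> costs less than \<open>h / 2\<close>; and
  only then the loss \<open>c\<close> granted to each of the coordinates in \<open>F\<close>, small enough that all of them together
  use up no more than half of \<open>d\<close>.
\<close>

proposition opial_property_lp_sum:
  assumes op: "\<And>i. i \<in> I \<Longrightarrow> opial_property (V i) (N i)"
  shows "opial_property (lp_sum p I V N) (lp_sum_norm p I N)"
  unfolding opial_property_iff_gap[OF subspace_lp_sum norm_on_lp_sum]
proof (intro allI impI)
  fix y x
  assume y: "weakly_null_on (lp_sum p I V N) (lp_sum_norm p I N) y"
    and x: "x \<in> lp_sum p I V N - {0}"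
  have yn: "y n \<in> lp_sum p I V N" for n using y unfolding weakly_null_on_def by blast
  have x': "x \<in> lp_sum p I V N" using x by blast
  obtain M where M: "\<And>n. lp_sum_norm p I N (y n) \<le> M"
    using weakly_null_on_bounded[OF subspace_lp_sum norm_on_lp_sum y] by blast
  obtain j where j: "j \<in> I" "x j \<noteq> 0" using x by (auto simp: lp_sum_def fun_eq_iff)
  obtain d where d: "0 < d"
    "\<forall>\<^sub>F n in sequentially. N j (y n j) powr p + d \<le> N j (y n j - x j) powr p"
    using opial_gap_powr[OF V[OF j(1)] N[OF j(1)] op[OF j(1)] p weakly_null_on_component[OF y j(1)]]
      lp_sum_component[OF x' j(1)] j(2) by blast
  obtain h where h: "0 < h" "\<And>s t. 0 \<le> s \<Longrightarrow> s \<le> M \<Longrightarrow> 0 \<le> t \<Longrightarrow>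
      s powr p + d / 2 \<le> t powr p \<Longrightarrow> s + h \<le> t"
    using powr_gap_root[OF p, of "d / 2" M] d(1) by auto
  obtain F where F: "finite F" "{j} \<subseteq> F" "F \<subseteq> I"
    "lp_sum_norm p I N (x - (\<lambda>i. if i \<in> F then x i else 0)) < h / 2"
    using lp_sum_approx_restrict[OF x', of "{j}" "h / 2"] h(1) j(1) by auto
  define c where "c = d / (2 * real (card F))"
  have card: "0 < card F" using F by (auto simp: card_gt_0_iff)
  have c: "0 < c" using card d(1) by (simp add: c_def)
  have "d / 2 = (\<Sum>i\<in>F. (if i = j then d else 0) - c)"
    using F(1,2) card by (auto simp: sum_subtractf c_def)
  also have "\<dots> \<le> (\<Sum>i\<in>F. if i = j then d else - c)" using c by (intro sum_mono) auto
  finally have sum_ge: "d / 2 \<le> (\<Sum>i\<in>F. if i = j then d else - c)" .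
  have "\<forall>\<^sub>F n in sequentially. lp_sum_norm p I N (y n) powr p + d / 2
      \<le> lp_sum_norm p I N (y n - (\<lambda>i. if i \<in> F then x i else 0)) powr p"
  proof (rule lp_sum_gap[OF yn x' F(1,3) _ sum_ge])
    fix i assume "i \<in> F"
    then have i: "i \<in> I" using F(3) by blast
    show "\<forall>\<^sub>F n in sequentially. N i (y n i) powr p + (if i = j then d else - c)
        \<le> N i (y n i - x i) powr p"
      using d(2) nonstrict_opial_gap_powr[OF V[OF i] N[OF i]
          opial_property_imp_nonstrict[OF op[OF i]] p
          weakly_null_on_component[OF y i] lp_sum_component[OF x' i] c] by simp
  qed
  then have "\<forall>\<^sub>F n in sequentially. lp_sum_norm p I N (y n) + h / 2 \<le> lp_sum_norm p I N (y n - x)"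
  proof eventually_elim
    case (elim n)
    have "lp_sum_norm p I N (y n) + h \<le> lp_sum_norm p I N (y n - (\<lambda>i. if i \<in> F then x i else 0))"
      by (rule h(2)[OF lp_sum_norm_nonneg M lp_sum_norm_nonneg elim])
    with lp_sum_norm_diff_le[OF yn x' restrict_in_lp_sum[OF x'], of n F] F(4) show ?case by simp
  qed
  with h(1) show "\<exists>d>0. \<forall>\<^sub>F n in sequentially.
      lp_sum_norm p I N (y n) + d \<le> lp_sum_norm p I N (y n - x)"
    by (intro exI[of _ "h / 2"]) auto
qed

end

theorem proposition3p11:
  fixes p :: real
    and I :: "'i set"
    and V :: "'i \<Rightarrow> 'b::real_vector set"
    and N :: "'i \<Rightarrow> 'b \<Rightarrow> real"
  assumes "1 \<le> p"
    and "\<And>i. i \<in> I \<Longrightarrow> banach_space_on (V i) (N i)"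
  shows "((\<forall>i\<in>I. opial_property (V i) (N i)) \<longrightarrow>
            opial_property (lp_sum p I V N) (lp_sum_norm p I N)) \<and>
         ((\<forall>i\<in>I. nonstrict_opial_property (V i) (N i)) \<longrightarrow>
            nonstrict_opial_property (lp_sum p I V N) (lp_sum_norm p I N))"
proof -
  have "subspace (V i)" "norm_on (V i) (N i)" if "i \<in> I" for i
    using assms(2)[OF that] unfolding banach_space_on_def by auto
  with assms(1) show ?thesis
    by (intro conjI impI opial_property_lp_sum nonstrict_opial_property_lp_sum) auto
qed

end
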